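(* Let the $\Omega$-minimizing solution $u^\dagger$ satisfy an approximate source condition with element $\xi\in\partial\Omega(u^\dagger)$ and distance function $\tilde d$. Let $F$ be nonlinear of degree $(c_1,c_2)$ with respect to $\Omega$, $u^\dagger$ and $\xi$ (with constants $\varrho,\bar\alpha,K$), where $c_2\in[0,1)$, $c_1\in(0,1-c_2]$ and $\frac{c_1}{1-c_2}<p$. Let $r_0>0$, and let $K_{\bar\alpha}>0$ be a constant with $\|u-u^\dagger\|_U\le K_{\bar\alpha}$ for all $u\in M_{\bar\alpha}(\varrho\bar\alpha)$. Then $u^\dagger$ satisfies an approximate variational inequality with element $\xi$, constants $\varrho$, $\bar\alpha$, exponent $\kappa=\frac{c_1}{1-c_2}\in(0,p)$ and suitable constants $\beta_1\in[0,1)$, $\beta_2\ge0$, $\gamma\ge0$, and the corresponding distance function $d$ satisfies $$d(r)\le K_{\bar\alpha}\,\tilde d(r)\quad\text{for all }r\ge r_0.$$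
   Context: Setting. $U$ and $V$ are real reflexive Banach spaces, and $\rightharpoonup$ denotes weak convergence in $U$ or $V$. $F:D(F)\subseteq U\to V$ is a (possibly nonlinear) operator, $v^0\in V$, $\Omega:U\to[0,\infty]$, $p\in(0,\infty)$. Put $D(\Omega)=\{u\in U:\Omega(u)<\infty\}$, $D=D(F)\cap D(\Omega)$, and for $\alpha>0$ $$\mathcal{T}_\alpha^0(u)=\|F(u)-v^0\|_V^p+\alpha\Omega(u),\qquad M_\alpha(c)=\{u\in D:\mathcal{T}_\alpha^0(u)\le c\}.$$ Standing assumptions. (i) $u_k\rightharpoonup u$ with $u,u_k\in D(F)$ implies $F(u_k)\rightharpoonup F(u)$. (ii) $D(F)$ is weakly sequentially closed. (iii) There is $u\in D$ with $F(u)=v^0$. (iv) $\Omega$ is convex. (v) $\Omega$ is weakly sequentially lower semicontinuous. (vi) For all $\alpha>0$, $c>0$, every sequence in $M_\alpha(c)$ has a weakly convergent subsequence. An $\Omega$-minimizing solution is an element $u^\dagger\in D$ with $F(u^\dagger)=v^0$ and $\Omega(u^\dagger)=\inf\{\Omega(u):u\in D,\ F(u)=v^0\}$; $u^\dagger$ is a fixed $\Omega$-minimizing solution with $\partial\Omega(u^\dagger)\ne\emptyset$, where $\partial\Omega(u^\dagger)=\{\xi\in U^*:\Omega(u)\ge\Omega(u^\dagger)+\langle\xi,u-u^\dagger\rangle_{U^*,U}\ \forall u\in U\}$. For $\xi\in\partial\Omega(u^\dagger)$ the Bregman distance is $\mathcal{B}_\xi(u,u^\dagger)=\Omega(u)-\Omega(u^\dagger)-\langle\xi,u-u^\dagger\rangle_{U^*,U}$.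 Since weakly sequentially pre-compact sets are bounded, the sets $M_\alpha(\varrho\alpha)$ are bounded. Further assumptions. (vii) $D(F)$ is starlike with respect to $u^\dagger$: for each $u\in D(F)$ there is $t_0>0$ with $u^\dagger+t(u-u^\dagger)\in D(F)$ for all $t\in[0,t_0]$. (viii) There is a bounded linear operator $F'(u^\dagger):U\to V$ such that for all $u\in D$, $$\Bigl\|\tfrac{F(u^\dagger+t(u-u^\dagger))-F(u^\dagger)}{t}-F'(u^\dagger)(u-u^\dagger)\Bigr\|_V\to0\quad\text{as }t\to+0.$$ $F'(u^\dagger)^*:V^*\to U^*$ is the adjoint of $F'(u^\dagger)$, and $\mathcal{R}(\cdot)$ denotes the range. Let $c_p=1$ if $0<p<1$ and $c_p=2^{p-1}$ if $p\ge1$. Approximate source condition: $u^\dagger$ satisfies an approximate source condition with element $\xi$ if $\xi\in\partial\Omega(u^\dagger)$ and $\xi\in\overline{\mathcal{R}(F'(u^\dagger)^* )}$ (norm closure); its distance function is $\tilde d(r)=\min\{\|\xi-F'(u^\dagger)^*\eta\|_{U^*}:\eta\in V^*,\ \|\eta\|_{V^*}\le r\}$, $r\ge0$. Degree of nonlinearity: for $c_1,c_2\ge0$, $F$ is nonlinear of degree $(c_1,c_2)$ with respect to $\Omega$, $u^\dagger$ and $\xi\in\partial\Omega(u^\dagger)$ if there are constants $\varrho>c_p\Omega(u^\dagger)$, $\bar\alpha>0$, $K>0$ with $$\|F(u)-F(u^\dagger)-F'(u^\dagger)(u-u^\dagger)\|_V\le K\|F(u)-F(u^\dagger)\|_V^{c_1}\,\mathcal{B}_\xi(u,u^\dagger)^{c_2}\quad\text{for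 all }u\in M_{\bar\alpha}(\varrho\bar\alpha),$$ where the factor $\mathcal{B}_\xi(u,u^\dagger)^{c_2}$ is read as $1$ if $c_2=0$. Approximate variational inequality: $u^\dagger$ satisfies an approximate variational inequality with element $\xi\in\partial\Omega(u^\dagger)$ and constants $\varrho>c_p\Omega(u^\dagger)$, $\bar\alpha>0$, $\beta_1\in[0,1)$, $\beta_2\ge0$, $\gamma\ge0$, $\kappa>0$ if the distance function $d:[0,\infty)\to\mathbb{R}$, $$d(r)=-\min_{u\in M_{\bar\alpha}(\varrho\bar\alpha)}\bigl(\langle\xi,u-u^\dagger\rangle_{U^*,U}+\beta_1\mathcal{B}_\xi(u,u^\dagger)+\beta_2r^\gamma\|F(u)-F(u^\dagger)\|_V^\kappa\bigr),$$ satisfies $d(r)\to0$ as $r\to\infty$ (the minimum exists under the standing assumptions). *)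

theory Defs
  imports "HOL-Analysis.Analysis"
begin

text \<open>The dual space of \<open>'a\<close> is \<open>'a \<Rightarrow>\<^sub>L real\<close>, with the operator norm and its norm topology.\<close>

text \<open>The canonical embedding into the bidual is onto.\<close>

definition reflexive_space :: "'a::banach itself \<Rightarrow> bool" where
  "reflexive_space _ \<longleftrightarrow>
     (\<forall>\<Phi> :: ('a \<Rightarrow>\<^sub>L real) \<Rightarrow>\<^sub>L real. \<exists>x::'a. \<forall>\<xi>. blinfun_apply \<Phi> \<xi> = blinfun_apply \<xi> x)"

definition weakly_tendsto :: "(nat \<Rightarrow> 'a::real_normed_vector) \<Rightarrow> 'a \<Rightarrow> bool" where
  "weakly_tendsto x l \<longleftrightarrow>
     (\<forall>\<xi> :: 'a \<Rightarrow>\<^sub>L real. (\<lambda>k. blinfun_apply \<xi> (x k)) \<longlonglongrightarrow> blinfun_apply \<xi> l)"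

definition weakly_seq_closed :: "'a::real_normed_vector set \<Rightarrow> bool" where
  "weakly_seq_closed S \<longleftrightarrow>
     (\<forall>x l. (\<forall>k. x k \<in> S) \<longrightarrow> weakly_tendsto x l \<longrightarrow> l \<in> S)"

definition weakly_seq_continuous_on ::
    "'a set \<Rightarrow> ('a::real_normed_vector \<Rightarrow> 'b::real_normed_vector) \<Rightarrow> bool" where
  "weakly_seq_continuous_on S F \<longleftrightarrow>
     (\<forall>x l. (\<forall>k. x k \<in> S) \<longrightarrow> l \<in> S \<longrightarrow> weakly_tendsto x l
        \<longrightarrow> weakly_tendsto (\<lambda>k. F (x k)) (F l))"

definition weakly_seq_lsc :: "('a::real_normed_vector \<Rightarrow> ennreal) \<Rightarrow> bool" where
  "weakly_seq_lsc \<Omega> \<longleftrightarrow>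
     (\<forall>x l. weakly_tendsto x l \<longrightarrow> \<Omega> l \<le> liminf (\<lambda>k. \<Omega> (x k)))"

definition weakly_seq_precompact :: "'a::real_normed_vector set \<Rightarrow> bool" where
  "weakly_seq_precompact S \<longleftrightarrow>
     (\<forall>x. (\<forall>k. x k \<in> S) \<longrightarrow> (\<exists>l s. strict_mono (s :: nat \<Rightarrow> nat) \<and> weakly_tendsto (x \<circ> s) l))"

definition convex_ennreal :: "('a::real_vector \<Rightarrow> ennreal) \<Rightarrow> bool" where
  "convex_ennreal \<Omega> \<longleftrightarrow>
     (\<forall>x y. \<forall>t\<in>{0..1}.
        \<Omega> ((1 - t) *\<^sub>R x + t *\<^sub>R y) \<le> ennreal (1 - t) * \<Omega> x + ennreal t * \<Omega> y)"

definition starlike_wrt :: "'a::real_vector set \<Rightarrow> 'a \<Rightarrow> bool" where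
  "starlike_wrt S a \<longleftrightarrow> (\<forall>u\<in>S. \<exists>t0>0. \<forall>t\<in>{0..t0}. a + t *\<^sub>R (u - a) \<in> S)"

definition adjoint_op ::
    "('a::real_normed_vector \<Rightarrow>\<^sub>L 'b::real_normed_vector) \<Rightarrow> ('b \<Rightarrow>\<^sub>L real) \<Rightarrow> ('a \<Rightarrow>\<^sub>L real)" where
  "adjoint_op A \<eta> = \<eta> o\<^sub>L A"

text \<open>Real power with \<open>x\<^sup>0 = 1\<close> for every \<open>x\<close>, in contrast to \<open>0 powr 0 = 0\<close>.\<close>

definition rpow :: "real \<Rightarrow> real \<Rightarrow> real" where
  "rpow x a = (if a = 0 then 1 else x powr a)"

text \<open>
  Throughout, a partial operator \<open>F : D(F) \<subseteq> U \<rightarrow> V\<close> is a total function together with a set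
  \<open>DF\<close>; values outside \<open>DF\<close> are never used. A functional \<open>U \<rightarrow> [0,\<infinity>]\<close> takes values in \<open>ennreal\<close>.
\<close>

definition penalized_dom :: "'u set \<Rightarrow> ('u \<Rightarrow> ennreal) \<Rightarrow> 'u set" where
  "penalized_dom DF \<Omega> = DF \<inter> {u. \<Omega> u < \<infinity>}"

definition tikhonov ::
    "('u \<Rightarrow> 'v::real_normed_vector) \<Rightarrow> 'v \<Rightarrow> ('u \<Rightarrow> ennreal) \<Rightarrow> real \<Rightarrow> real \<Rightarrow> 'u \<Rightarrow> ennreal" where
  "tikhonov F v0 \<Omega> p \<alpha> u = ennreal (norm (F u - v0) powr p) + ennreal \<alpha> * \<Omega> u"

text \<open>The level \<open>c\<close> and the parameter \<open>\<alpha>\<close> are only used for positive values.\<close>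

definition sublevel ::
    "('u \<Rightarrow> 'v::real_normed_vector) \<Rightarrow> 'u set \<Rightarrow> 'v \<Rightarrow> ('u \<Rightarrow> ennreal) \<Rightarrow> real \<Rightarrow> real \<Rightarrow> real \<Rightarrow> 'u set"
  where
  "sublevel F DF v0 \<Omega> p \<alpha> c = {u \<in> penalized_dom DF \<Omega>. tikhonov F v0 \<Omega> p \<alpha> u \<le> ennreal c}"

definition minimizing_solution ::
    "('u \<Rightarrow> 'v) \<Rightarrow> 'u set \<Rightarrow> 'v \<Rightarrow> ('u \<Rightarrow> ennreal) \<Rightarrow> 'u \<Rightarrow> bool" where
  "minimizing_solution F DF v0 \<Omega> ud \<longleftrightarrow>
     ud \<in> penalized_dom DF \<Omega> \<and> F ud = v0 \<and>
     \<Omega> ud = (INF u \<in> {u \<in> penalized_dom DF \<Omega>. F u = v0}. \<Omega> u)"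

definition subdifferential ::
    "('u::real_normed_vector \<Rightarrow> ennreal) \<Rightarrow> 'u \<Rightarrow> ('u \<Rightarrow>\<^sub>L real) set" where
  "subdifferential \<Omega> ud =
     {\<xi>. \<forall>u. enn2ereal (\<Omega> u) \<ge> enn2ereal (\<Omega> ud) + ereal (blinfun_apply \<xi> (u - ud))}"

text \<open>Real-valued, hence only meaningful where \<open>\<Omega> u\<close> and \<open>\<Omega> ud\<close> are finite.\<close>

definition bregman ::
    "('u::real_normed_vector \<Rightarrow> ennreal) \<Rightarrow> ('u \<Rightarrow>\<^sub>L real) \<Rightarrow> 'u \<Rightarrow> 'u \<Rightarrow> real" where
  "bregman \<Omega> \<xi> u ud = enn2real (\<Omega> u) - enn2real (\<Omega> ud) - blinfun_apply \<xi> (u - ud)"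

definition c_exp :: "real \<Rightarrow> real" where
  "c_exp p = (if p < 1 then 1 else 2 powr (p - 1))"

definition approx_source_condition ::
    "('u::real_normed_vector \<Rightarrow>\<^sub>L 'v::real_normed_vector) \<Rightarrow> ('u \<Rightarrow> ennreal) \<Rightarrow> 'u \<Rightarrow> ('u \<Rightarrow>\<^sub>L real) \<Rightarrow> bool"
  where
  "approx_source_condition F' \<Omega> ud \<xi> \<longleftrightarrow>
     \<xi> \<in> subdifferential \<Omega> ud \<and> \<xi> \<in> closure (range (adjoint_op F'))"

text \<open>
  In both distance functions the minimum of a set \<open>S\<close> of reals is \<open>LEAST m. m \<in> S\<close>, the element of
  \<open>S\<close> below all others; this is not the infimum, so a bound on it needs attainment.
\<close>

definition source_distance ::
    "('u::real_normed_vector \<Rightarrow>\<^sub>L 'v::real_normed_vector) \<Rightarrow> ('u \<Rightarrow>\<^sub>L real) \<Rightarrow> real \<Rightarrow> real" where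
  "source_distance F' \<xi> r =
     (LEAST m. m \<in> (\<lambda>\<eta>. norm (\<xi> - adjoint_op F' \<eta>)) ` {\<eta>. norm \<eta> \<le> r})"

definition nonlinear_of_degree ::
    "('u::real_normed_vector \<Rightarrow> 'v::real_normed_vector) \<Rightarrow> 'u set \<Rightarrow> 'v \<Rightarrow> ('u \<Rightarrow> ennreal) \<Rightarrow> real
      \<Rightarrow> ('u \<Rightarrow>\<^sub>L 'v) \<Rightarrow> 'u \<Rightarrow> ('u \<Rightarrow>\<^sub>L real) \<Rightarrow> real \<Rightarrow> real \<Rightarrow> real \<Rightarrow> real \<Rightarrow> real \<Rightarrow> bool" where
  "nonlinear_of_degree F DF v0 \<Omega> p F' ud \<xi> c1 c2 \<rho> \<alpha> K \<longleftrightarrow>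
     0 \<le> c1 \<and> 0 \<le> c2 \<and> \<xi> \<in> subdifferential \<Omega> ud \<and>
     ennreal (c_exp p) * \<Omega> ud < ennreal \<rho> \<and> 0 < \<alpha> \<and> 0 < K \<and>
     (\<forall>u \<in> sublevel F DF v0 \<Omega> p \<alpha> (\<rho> * \<alpha>).
        norm (F u - F ud - blinfun_apply F' (u - ud))
          \<le> K * rpow (norm (F u - F ud)) c1 * rpow (bregman \<Omega> \<xi> u ud) c2)"

definition vi_distance ::
    "('u::real_normed_vector \<Rightarrow> 'v::real_normed_vector) \<Rightarrow> 'u set \<Rightarrow> 'v \<Rightarrow> ('u \<Rightarrow> ennreal) \<Rightarrow> real
      \<Rightarrow> 'u \<Rightarrow> ('u \<Rightarrow>\<^sub>L real) \<Rightarrow> real \<Rightarrow> real \<Rightarrow> real \<Rightarrow> real \<Rightarrow> real \<Rightarrow> real \<Rightarrow> real \<Rightarrow> real" where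
  "vi_distance F DF v0 \<Omega> p ud \<xi> \<rho> \<alpha> \<beta>1 \<beta>2 \<gamma> \<kappa> r =
     - (LEAST m. m \<in>
          (\<lambda>u. blinfun_apply \<xi> (u - ud) + \<beta>1 * bregman \<Omega> \<xi> u ud
                + \<beta>2 * rpow r \<gamma> * rpow (norm (F u - F ud)) \<kappa>)
            ` sublevel F DF v0 \<Omega> p \<alpha> (\<rho> * \<alpha>))"

definition approx_variational_inequality ::
    "('u::real_normed_vector \<Rightarrow> 'v::real_normed_vector) \<Rightarrow> 'u set \<Rightarrow> 'v \<Rightarrow> ('u \<Rightarrow> ennreal) \<Rightarrow> real
      \<Rightarrow> 'u \<Rightarrow> ('u \<Rightarrow>\<^sub>L real) \<Rightarrow> real \<Rightarrow> real \<Rightarrow> real \<Rightarrow> real \<Rightarrow> real \<Rightarrow> real \<Rightarrow> bool" where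
  "approx_variational_inequality F DF v0 \<Omega> p ud \<xi> \<rho> \<alpha> \<beta>1 \<beta>2 \<gamma> \<kappa> \<longleftrightarrow>
     \<xi> \<in> subdifferential \<Omega> ud \<and>
     ennreal (c_exp p) * \<Omega> ud < ennreal \<rho> \<and> 0 < \<alpha> \<and>
     0 \<le> \<beta>1 \<and> \<beta>1 < 1 \<and> 0 \<le> \<beta>2 \<and> 0 \<le> \<gamma> \<and> 0 < \<kappa> \<and>
     (vi_distance F DF v0 \<Omega> p ud \<xi> \<rho> \<alpha> \<beta>1 \<beta>2 \<gamma> \<kappa> \<longlongrightarrow> 0) at_top"

end

theory Submission
  imports Defs
begin

text \<open>
  Choosing \<open>\<eta>\<close> optimal in \<open>d\<^sub>\<xi>(r) = min {\<parallel>\<xi> - F'* \<eta>\<parallel> | \<parallel>\<eta>\<parallel> \<le> r}\<close>, one has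
  \<open>- \<langle>\<xi>, u - u\<dagger>\<rangle> \<le> K\<^sub>\<alpha> d\<^sub>\<xi>(r) + r \<parallel>F'(u - u\<dagger>)\<parallel>\<close>, and the degree of nonlinearity bounds the last norm by
  \<open>N + K N\<^bsup>c1\<^esup> B\<^bsup>c2\<^esup>\<close>, where \<open>N = \<parallel>F u - F u\<dagger>\<parallel>\<close> and \<open>B\<close> is the Bregman distance.  Young's inequality
  with weights \<open>1 - c2\<close> and \<open>c2\<close> splits off \<open>c2 B\<close> and leaves a multiple of \<open>r\<^bsup>\<gamma>\<^esup> N\<^bsup>\<kappa>\<^esup>\<close> with
  \<open>\<gamma> = 1 / (1 - c2)\<close>, so \<open>\<beta>1 = c2\<close>; the term \<open>r N\<close> is absorbed because \<open>N\<close> is bounded on the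
  sublevel set and \<open>r\<close> is bounded below.  Both minima are attained: the one over \<open>\<eta>\<close> by weak*
  compactness of dual balls (Tychonoff), the one over \<open>u\<close> by weak sequential compactness, where weak
  lower semicontinuity of the norm needs the Hahn-Banach theorem.
\<close>

section \<open>Sublinear functionals, the Hahn-Banach theorem and weak limits of norms\<close>

definition sublinear :: "('a::real_vector \<Rightarrow> real) \<Rightarrow> bool" where
  "sublinear q \<longleftrightarrow> (\<forall>x y. q (x + y) \<le> q x + q y) \<and> (\<forall>x. \<forall>c\<ge>0. q (c *\<^sub>R x) = c * q x)"

lemma sublinear_add: "sublinear q \<Longrightarrow> q (x + y) \<le> q x + q y"
  by (simp add: sublinear_def)

lemma sublinear_scaleR: "sublinear q \<Longrightarrow> 0 \<le> c \<Longrightarrow> q (c *\<^sub>R x) = c * q x"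
  by (simp add: sublinear_def)

lemma sublinear_0: "sublinear q \<Longrightarrow> q 0 = 0"
  using sublinear_scaleR[of q 0 0] by simp

lemma sublinear_minus: "sublinear q \<Longrightarrow> - q (- x) \<le> q x"
  using sublinear_add[of q x "- x"] by (simp add: sublinear_0)

text \<open>One inequality is enough for positive homogeneity: applied with \<open>inverse c\<close>
  it turns into the reverse one, and \<open>c = 0\<close> is covered by
  \<open>q 0 = 0\<close>.\<close>

lemma sublinearI:
  assumes add: "\<And>x y. q (x + y) \<le> q x + q y"
    and scale: "\<And>x c. 0 < c \<Longrightarrow> q (c *\<^sub>R x) \<le> c * q x"
    and zero: "q 0 = 0"
  shows "sublinear q"
  unfolding sublinear_def
proof (intro conjI allI impI)
  fix x and c :: real
  assume "0 \<le> c"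
  show "q (c *\<^sub>R x) = c * q x"
  proof (cases "c = 0")
    case False
    with \<open>0 \<le> c\<close> have c: "0 < c" by simp
    have "q (inverse c *\<^sub>R (c *\<^sub>R x)) \<le> inverse c * q (c *\<^sub>R x)"
      using c by (intro scale) simp
    then have "c * q x \<le> q (c *\<^sub>R x)"
      using c by (simp add: field_simps)
    with scale[OF c, of x] show ?thesis by simp
  qed (simp add: zero)
qed (rule add)

text \<open>For a minimal \<open>q\<close> the functional \<open>q'\<close> equals \<open>q\<close>, and the last property gives additivity.  Starting
  from the norm, the value at \<open>- y\<close> forces linear functionals below \<open>q'\<close> to be norming at \<open>y\<close>.\<close>

lemma sublinear_reduce:
  assumes q: "sublinear q"
  obtains q' where "sublinear q'" "q' \<le> q" "q' (- y) \<le> - q y"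
    "\<forall>x. q' x \<le> q (x + y) - q y"
proof -
  define S where "S x = (\<lambda>t. q (x + t *\<^sub>R y) - t * q y) ` {0..}" for x
  define q' where "q' x = Inf (S x)" for x
  \<comment> \<open>The infimum \<open>q'\<close> is finite: subadditivity gives
    \<open>t * q y \<le> q (x + t *\<^sub>R y) + q (- x)\<close>, a bound uniform in
    \<open>t\<close>.\<close>
  have below: "- q (- x) \<le> s" if "s \<in> S x" for s x
  proof -
    from that obtain t where t: "0 \<le> t" "s = q (x + t *\<^sub>R y) - t * q y"
      by (auto simp: S_def)
    have "q (t *\<^sub>R y) \<le> q (x + t *\<^sub>R y) + q (- x)"
      using sublinear_add[OF q, of "x + t *\<^sub>R y" "- x"] by simp
    with t show ?thesis by (simp add: sublinear_scaleR[OF q])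
  qed
  have bdd: "bdd_below (S x)" for x
    using below by (rule bdd_belowI)
  have ne: "S x \<noteq> {}" for x by (auto simp: S_def)
  have le: "q' x \<le> q (x + t *\<^sub>R y) - t * q y" if "0 \<le> t" for x t
    unfolding q'_def using that by (intro cInf_lower bdd) (auto simp: S_def)
  have ge: "m \<le> q' x" if "\<And>t. 0 \<le> t \<Longrightarrow> m \<le> q (x + t *\<^sub>R y) - t * q y" for m x
    unfolding q'_def using that by (intro cInf_greatest ne) (auto simp: S_def)
  have "sublinear q'"
  proof (rule sublinearI)
    fix x z
    \<comment> \<open>Parameters \<open>t\<close> for \<open>x\<close> and \<open>s\<close> for
      \<open>z\<close> combine to the admissible parameter \<open>t + s\<close> for
      \<open>x + z\<close>; afterwards the two infima are taken one at a time.\<close>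
    have "q' (x + z) - (q (z + s *\<^sub>R y) - s * q y) \<le> q (x + t *\<^sub>R y) - t * q y"
      if "0 \<le> t" "0 \<le> s" for s t
    proof -
      have "q' (x + z) \<le> q ((x + t *\<^sub>R y) + (z + s *\<^sub>R y)) - (t + s) * q y"
        using le[of "t + s" "x + z"] that by (simp add: algebra_simps)
      also have "\<dots> \<le> q (x + t *\<^sub>R y) + q (z + s *\<^sub>R y) - (t + s) * q y"
        using sublinear_add[OF q] by simp
      finally show ?thesis by (simp add: algebra_simps)
    qed
    then have "q' (x + z) - (q (z + s *\<^sub>R y) - s * q y) \<le> q' x" if "0 \<le> s" for s
      using that by (intro ge) auto
    then have "q' (x + z) - q' x \<le> q' z"
      by (intro ge) (simp add: algebra_simps)
    then show "q' (x + z) \<le> q' x + q' z" by simp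
  next
    fix x and c :: real
    assume c: "0 < c"
    have "inverse c * q' (c *\<^sub>R x) \<le> q' x"
    proof (rule ge)
      fix t :: real
      assume t: "0 \<le> t"
      \<comment> \<open>The parameter \<open>t\<close> at \<open>x\<close> corresponds to
        \<open>c * t\<close> at \<open>c *\<^sub>R x\<close>.\<close>
      have "q' (c *\<^sub>R x) \<le> q (c *\<^sub>R x + (c * t) *\<^sub>R y) - c * t * q y"
        using c t by (intro le) simp
      also have "c *\<^sub>R x + (c * t) *\<^sub>R y = c *\<^sub>R (x + t *\<^sub>R y)"
        by (simp add: scaleR_right_distrib)
      also have "q \<dots> = c * q (x + t *\<^sub>R y)"
        using c by (simp add: sublinear_scaleR[OF q])
      finally show "inverse c * q' (c *\<^sub>R x) \<le> q (x + t *\<^sub>R y) - t * q y"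
        using c by (simp add: field_simps)
    qed
    then show "q' (c *\<^sub>R x) \<le> c * q' x"
      using c by (simp add: field_simps)
  next
    have "q' 0 \<le> 0" using le[of 0 0] by (simp add: sublinear_0[OF q])
    moreover have "0 \<le> q' 0" by (rule ge) (simp add: sublinear_scaleR[OF q])
    ultimately show "q' 0 = 0" by simp
  qed
  moreover have "q' \<le> q" using le[of 0] by (simp add: le_fun_def)
  moreover have "q' (- y) \<le> - q y" using le[of 1 "- y"] by (simp add: sublinear_0[OF q])
  moreover have "\<forall>x. q' x \<le> q (x + y) - q y" using le[of 1] by simp
  ultimately show ?thesis by (rule that)
qed

text \<open>Zorn's lemma with the pointwise infimum as lower bound of a chain. The infimum is finite
  because every sublinear \<open>f \<le> q\<close> satisfies
  \<open>- q (- x) \<le> f x\<close>.\<close>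

lemma sublinear_minimal:
  assumes q: "sublinear q"
  obtains f where "sublinear f" "f \<le> q" "\<forall>g. sublinear g \<longrightarrow> g \<le> f \<longrightarrow> g = f"
proof -
  define A where "A = {f. sublinear f \<and> f \<le> q}"
  have lower: "- q (- x) \<le> f x" if "f \<in> A" for f x
  proof -
    have "- q (- x) \<le> - f (- x)" using that by (simp add: A_def le_fun_def)
    also have "\<dots> \<le> f x" using that by (intro sublinear_minus) (simp add: A_def)
    finally show ?thesis .
  qed
  have "\<exists>m\<in>A. \<forall>a\<in>A. a \<le> m \<longrightarrow> a = m"
  \<comment> \<open>The order is reversed, so that the maximal element of Zorn's lemma is pointwise
    minimal.\<close>
  proof (rule predicate_Zorn)
    show "partial_order_on A (relation_of (\<lambda>f g. g \<le> f) A)"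
      by (rule partial_order_on_relation_ofI) auto
  next
    fix C
    assume "C \<in> Chains (relation_of (\<lambda>f g. g \<le> f) A)"
    then have C: "C \<subseteq> A" and tot: "\<And>f g. f \<in> C \<Longrightarrow> g \<in> C \<Longrightarrow> f \<le> g \<or> g \<le> f"
      by (auto simp: Chains_def relation_of_def)
    show "\<exists>u\<in>A. \<forall>a\<in>C. u \<le> a"
    proof (cases "C = {}")
      case True
      with q show ?thesis by (auto simp: A_def)
    next
      case False
      define u where "u x = (INF f\<in>C. f x)" for x
      have le: "u x \<le> f x" if "f \<in> C" for f x
        unfolding u_def using that C lower by (intro cINF_lower bdd_belowI2[of _ "- q (- x)"]) auto
      have ge: "m \<le> u x" if "\<And>f. f \<in> C \<Longrightarrow> m \<le> f x" for m x
        unfolding u_def using that False by (intro cINF_greatest) auto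
      have sub: "sublinear f" if "f \<in> C" for f
        using that C by (auto simp: A_def)
      have "sublinear u"
      proof (rule sublinearI)
        fix x y
        have "u (x + y) - g y \<le> f x" if fg: "f \<in> C" "g \<in> C" for f g
        proof -
          \<comment> \<open>Totality of the chain enters here: the smaller of \<open>f\<close> and
            \<open>g\<close> serves for both arguments.\<close>
          obtain h where h: "h \<in> C" "h \<le> f" "h \<le> g"
            using tot[OF fg] fg by blast
          have "u (x + y) \<le> h x + h y"
            by (rule order_trans[OF le[OF h(1)] sublinear_add[OF sub[OF h(1)]]])
          also have "\<dots> \<le> f x + g y"
            using h(2,3) by (intro add_mono) (auto simp: le_fun_def)
          finally show ?thesis by simp
        qed
        then have "u (x + y) - g y \<le> u x" if "g \<in> C" for g
          using that by (intro ge)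
        then have "u (x + y) - u x \<le> u y"
          by (intro ge) (simp add: algebra_simps)
        then show "u (x + y) \<le> u x + u y" by simp
      next
        fix x and c :: real
        assume c: "0 < c"
        have "inverse c * u (c *\<^sub>R x) \<le> u x"
        proof (rule ge)
          fix f assume f: "f \<in> C"
          have "u (c *\<^sub>R x) \<le> c * f x"
            using le[OF f, of "c *\<^sub>R x"] c by (simp add: sublinear_scaleR[OF sub[OF f]])
          then show "inverse c * u (c *\<^sub>R x) \<le> f x"
            using c by (simp add: field_simps)
        qed
        then show "u (c *\<^sub>R x) \<le> c * u x"
          using c by (simp add: field_simps)
      next
        obtain f where f: "f \<in> C" using False by blast
        have "u 0 \<le> 0" using le[OF f, of 0] sublinear_0[OF sub[OF f]] by simp
        moreover have "0 \<le> u 0" by (rule ge) (simp add: sublinear_0[OF sub])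
        ultimately show "u 0 = 0" by simp
      qed
      moreover have "u \<le> q"
      proof -
        obtain f where f: "f \<in> C" using False by blast
        with C have "f \<le> q" by (auto simp: A_def)
        then show ?thesis using order_trans[OF le[OF f]] by (simp add: le_fun_def)
      qed
      ultimately show ?thesis
        using le by (auto simp: A_def le_fun_def)
    qed
  qed
  then obtain m where m: "m \<in> A" "\<And>a. a \<in> A \<Longrightarrow> a \<le> m \<Longrightarrow> a = m" by blast
  show ?thesis
  proof (rule that)
    show "sublinear m" "m \<le> q" using m(1) by (auto simp: A_def)
    have "g \<le> q" if "g \<le> m" for g
      using that \<open>m \<le> q\<close> by (rule order_trans)
    with m(2) show "\<forall>g. sublinear g \<longrightarrow> g \<le> m \<longrightarrow> g = m"
      by (simp add: A_def)
  qed
qed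

text \<open>A minimal sublinear functional below \<open>q\<close> is already linear: reducing it in
  direction \<open>y\<close> cannot change it, which gives superadditivity, and additivity extends
  homogeneity to negative scalars.\<close>

lemma Hahn_Banach_sublinear:
  assumes "sublinear q"
  obtains f where "linear f" "f \<le> q"
proof -
  obtain f where f: "sublinear f" "f \<le> q" and min: "\<forall>g. sublinear g \<longrightarrow> g \<le> f \<longrightarrow> g = f"
    by (rule sublinear_minimal[OF assms])
  have add: "f (x + y) = f x + f y" for x y
  proof -
    obtain g where g: "sublinear g" "g \<le> f" "g (- y) \<le> - f y"
        "\<forall>x. g x \<le> f (x + y) - f y"
      by (rule sublinear_reduce[OF f(1), where y = y])
    have "g = f" using min g(1,2) by simp
    with g(4) have "f x \<le> f (x + y) - f y" by simp
    with sublinear_add[OF f(1), of x y] show ?thesis by simp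
  qed
  have neg: "f (- x) = - f x" for x
    using add[of x "- x"] by (simp add: sublinear_0[OF f(1)])
  have "f (c *\<^sub>R x) = c * f x" for c x
  proof (cases "0 \<le> c")
    case False
    then have "f ((- c) *\<^sub>R x) = - c * f x" by (intro sublinear_scaleR f) simp
    then show ?thesis using neg[of "c *\<^sub>R x"] by simp
  qed (rule sublinear_scaleR[OF f(1)])
  with add have "linear f" by (intro linearI) auto
  then show ?thesis using f(2) by (rule that)
qed

text \<open>The norm is reduced in direction \<open>x\<close> before Hahn-Banach is applied. Any
  linear \<open>f\<close> below the result has \<open>- f x = f (- x) \<le> - norm x\<close>, while
  \<open>f \<le> norm\<close> gives the opposite bound.\<close>

lemma norming_functional:
  fixes x :: "'a::real_normed_vector"
  obtains f :: "'a \<Rightarrow>\<^sub>L real" where "norm f \<le> 1" "blinfun_apply f x = norm x"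
proof -
  have "sublinear (norm :: 'a \<Rightarrow> real)"
    by (simp add: sublinear_def norm_triangle_ineq)
  then obtain q where q: "sublinear q" "q \<le> norm" "q (- x) \<le> - norm x"
      "\<forall>z. q z \<le> norm (z + x) - norm x"
    by (rule sublinear_reduce[where y = x])
  obtain f where f: "linear f" "f \<le> q"
    by (rule Hahn_Banach_sublinear[OF q(1)])
  have le: "f z \<le> norm z" for z using order_trans[OF f(2) q(2)] by (simp add: le_fun_def)
  have abs: "\<bar>f z\<bar> \<le> norm z" for z
    using le[of z] le[of "- z"] by (simp add: linear_neg[OF f(1)])
  have bl: "bounded_linear f"
    using f(1) abs by (intro bounded_linear_intro[where K = 1]) (auto simp: linear_add linear_cmul)
  have "norm x \<le> f x"
    using le_funD[OF f(2), of "- x"] q(3) by (simp add: linear_neg[OF f(1)])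
  with le[of x] have "f x = norm x" by simp
  moreover have "norm (Blinfun f) \<le> 1"
    using abs by (intro norm_blinfun_bound) (auto simp: bounded_linear_Blinfun_apply[OF bl])
  ultimately show ?thesis
    by (intro that[of "Blinfun f"]) (auto simp: bounded_linear_Blinfun_apply[OF bl])
qed

text \<open>A functional of norm at most 1 that norms \<open>l - a\<close> passes to the weak limit
  and stays below the norms along the sequence.\<close>

lemma weakly_tendsto_norm_le:
  assumes "weakly_tendsto x l" and "(\<lambda>k. norm (x k - a)) \<longlonglongrightarrow> \<nu>"
  shows "norm (l - a) \<le> \<nu>"
proof -
  obtain f :: "'a \<Rightarrow>\<^sub>L real" where f: "norm f \<le> 1" "blinfun_apply f (l - a) = norm (l - a)"
    by (rule norming_functional)
  have "(\<lambda>k. blinfun_apply f (x k - a)) \<longlonglongrightarrow> blinfun_apply f (l - a)"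
    using assms(1) by (auto simp: weakly_tendsto_def blinfun.diff_right intro!: tendsto_diff)
  moreover have "blinfun_apply f (x k - a) \<le> norm (x k - a)" for k
  proof -
    have "blinfun_apply f (x k - a) \<le> norm f * norm (x k - a)"
      using norm_blinfun[of f "x k - a"] by simp
    also have "\<dots> \<le> norm (x k - a)"
      using f(1) mult_right_mono[of "norm f" 1 "norm (x k - a)"] by simp
    finally show ?thesis .
  qed
  ultimately have "blinfun_apply f (l - a) \<le> \<nu>"
    using assms(2) by (intro LIMSEQ_le) auto
  with f(2) show ?thesis by simp
qed

section \<open>The distance function of the source condition\<close>

text \<open>The dual norm is not continuous for pointwise convergence, so the residual norm is
  encoded by an extra coordinate \<open>c\<close> bounding it. Minimizing the residual becomes
  minimizing the continuous map \<open>snd\<close> over a compact set of pairs.\<close>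

lemma source_distance_attained:
  fixes A :: "'u::real_normed_vector \<Rightarrow>\<^sub>L 'v::real_normed_vector" and \<xi> :: "'u \<Rightarrow>\<^sub>L real"
  assumes r: "0 \<le> r"
  obtains \<eta> where "norm \<eta> \<le> r" "source_distance A \<xi> r = norm (\<xi> - adjoint_op A \<eta>)"
    "\<And>\<eta>'. norm \<eta>' \<le> r \<Longrightarrow> norm (\<xi> - adjoint_op A \<eta>) \<le> norm (\<xi> - adjoint_op A \<eta>')"
proof -
  \<comment> \<open>The cap \<open>norm \<xi>\<close> on \<open>c\<close> is the residual of
    \<open>\<eta> = 0\<close>; it makes the second factor compact while \<open>Z\<close> stays
    nonempty.\<close>
  define Z :: "(('v \<Rightarrow> real) \<times> real) set" where
    "Z = (Pi\<^sub>E UNIV (\<lambda>v. {- (r * norm v)..r * norm v}) \<times> {0..norm \<xi>})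
       \<inter> {(f, c). (\<forall>v w. f (v + w) = f v + f w) \<and> (\<forall>s v. f (s *\<^sub>R v) = s * f v)
                 \<and> (\<forall>x. \<bar>\<xi> x - f (A x)\<bar> \<le> c * norm x)}"
  \<comment> \<open>Evaluation at \<open>v\<close> is continuous in the product topology, so
    linearity and the residual bound are closed conditions.\<close>
  have cont: "continuous_on UNIV (\<lambda>z :: ('v \<Rightarrow> real) \<times> real. fst z v)" for v
    by (intro continuous_on_product_then_coordinatewise[where f = fst] continuous_on_fst continuous_on_id)
  have "compact Z"
    unfolding Z_def
  proof (rule compact_Int_closed)
    have "compact (Pi\<^sub>E UNIV (\<lambda>v. {- (r * norm v)..r * norm v}) :: ('v \<Rightarrow> real) set)"
      using compactin_PiE[of "\<lambda>_. euclidean" UNIV "\<lambda>v::'v. {- (r * norm v)..r * norm v}"]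
      by (simp add: euclidean_product_topology)
    then show "compact (Pi\<^sub>E UNIV (\<lambda>v::'v. {- (r * norm v)..r * norm v}) \<times> {0..norm \<xi>})"
      by (intro compact_Times) auto
    show "closed {(f :: 'v \<Rightarrow> real, c). (\<forall>v w. f (v + w) = f v + f w)
                 \<and> (\<forall>s v. f (s *\<^sub>R v) = s * f v) \<and> (\<forall>x. \<bar>\<xi> x - f (A x)\<bar> \<le> c * norm x)}"
      unfolding split_def
      by (intro closed_Collect_conj closed_Collect_all closed_Collect_eq closed_Collect_le
          cont continuous_on_add continuous_on_diff continuous_on_mult continuous_on_rabs
          continuous_on_const continuous_on_snd continuous_on_id)
  qed
  have rep: "(blinfun_apply \<eta>, norm (\<xi> - adjoint_op A \<eta>)) \<in> Z"
    if "norm \<eta> \<le> r" "norm (\<xi> - adjoint_op A \<eta>) \<le> norm \<xi>" for \<eta>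
  proof -
    have "\<bar>\<eta> v\<bar> \<le> r * norm v" for v
      using norm_blinfun[of \<eta> v] mult_right_mono[OF that(1) norm_ge_zero[of v]] by simp
    then have "- (r * norm v) \<le> \<eta> v \<and> \<eta> v \<le> r * norm v" for v
      by (simp add: abs_le_iff minus_le_iff)
    moreover have "\<bar>\<xi> x - \<eta> (A x)\<bar> \<le> norm (\<xi> - adjoint_op A \<eta>) * norm x" for x
      using norm_blinfun[of "\<xi> - adjoint_op A \<eta>" x]
      by (simp add: adjoint_op_def blinfun.diff_left)
    ultimately show ?thesis
      using that by (auto simp: Z_def blinfun.add_right blinfun.scaleR_right)
  qed
  have "(blinfun_apply 0, norm (\<xi> - adjoint_op A 0)) \<in> Z"
    using r by (intro rep) (auto simp: adjoint_op_def)
  then have "Z \<noteq> {}" by blast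
  then obtain z where z: "z \<in> Z" "\<And>y. y \<in> Z \<Longrightarrow> snd z \<le> snd y"
    using continuous_attains_inf[OF \<open>compact Z\<close> _ continuous_on_snd[OF continuous_on_id]]
    by blast
  define f c where "f = fst z" and "c = snd z"
  have f: "\<And>v w. f (v + w) = f v + f w" "\<And>s v. f (s *\<^sub>R v) = s * f v"
    and bound: "\<And>v. \<bar>f v\<bar> \<le> r * norm v"
    and c: "0 \<le> c" "c \<le> norm \<xi>" "\<And>x. \<bar>\<xi> x - f (A x)\<bar> \<le> c * norm x"
    using z(1) by (auto simp: Z_def f_def c_def PiE_def Pi_def abs_le_iff minus_le_iff)
  have bl: "bounded_linear f"
    using f bound by (intro bounded_linear_intro[where K = r]) (auto simp: mult.commute)
  define \<eta> where "\<eta> = Blinfun f"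
  have \<eta>: "blinfun_apply \<eta> = f"
    by (simp add: \<eta>_def bounded_linear_Blinfun_apply[OF bl])
  have n\<eta>: "norm \<eta> \<le> r"
    using r bound by (intro norm_blinfun_bound) (auto simp: \<eta>)
  have d\<eta>: "norm (\<xi> - adjoint_op A \<eta>) \<le> c"
    using c by (intro norm_blinfun_bound) (auto simp: adjoint_op_def blinfun.diff_left \<eta>)
  have min: "norm (\<xi> - adjoint_op A \<eta>) \<le> norm (\<xi> - adjoint_op A \<eta>')" if "norm \<eta>' \<le> r" for \<eta>'
  \<comment> \<open>A competitor with residual above \<open>norm \<xi>\<close> is not represented in
    \<open>Z\<close>, but it loses anyway since \<open>c \<le> norm \<xi>\<close>.\<close>
  proof (cases "norm (\<xi> - adjoint_op A \<eta>') \<le> norm \<xi>")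
    case True
    with that have "c \<le> norm (\<xi> - adjoint_op A \<eta>')"
      using z(2)[OF rep] by (simp add: c_def)
    with d\<eta> show ?thesis by simp
  qed (use d\<eta> c(2) in simp)
  have "source_distance A \<xi> r = norm (\<xi> - adjoint_op A \<eta>)"
    unfolding source_distance_def using n\<eta> min by (intro Least_equality) auto
  then show ?thesis using n\<eta> min by (intro that)
qed

text \<open>An \<open>\<eta>\<close> with residual below \<open>e\<close> is a competitor for every
  \<open>r \<ge> norm \<eta>\<close>.\<close>

lemma source_distance_tendsto_0:
  assumes "\<xi> \<in> closure (range (adjoint_op A))"
  shows "(source_distance A \<xi> \<longlongrightarrow> 0) at_top"
proof (rule tendstoI)
  fix e :: real
  assume "0 < e"
  with assms obtain \<eta> where \<eta>: "norm (\<xi> - adjoint_op A \<eta>) < e"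
    by (metis closure_approachable dist_commute dist_norm imageE)
  have "dist (source_distance A \<xi> r) 0 < e" if r: "norm \<eta> \<le> r" for r
  proof -
    have "0 \<le> r" using norm_ge_zero r by (rule order_trans)
    then obtain \<zeta> where "source_distance A \<xi> r = norm (\<xi> - adjoint_op A \<zeta>)"
      "norm (\<xi> - adjoint_op A \<zeta>) \<le> norm (\<xi> - adjoint_op A \<eta>)"
      using source_distance_attained r by metis
    with \<eta> show ?thesis by simp
  qed
  then show "\<forall>\<^sub>F r in at_top. dist (source_distance A \<xi> r) 0 < e"
    unfolding eventually_at_top_linorder by blast
qed

section \<open>Sublevel sets of the Tikhonov functional and existence of minimizers\<close>

lemma sublevel_iff:
  assumes "0 \<le> \<alpha>" "0 \<le> c"
  shows "u \<in> sublevel F DF v0 \<Omega> p \<alpha> c \<longleftrightarrow>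
    u \<in> DF \<and> \<Omega> u < \<infinity> \<and> norm (F u - v0) powr p + \<alpha> * enn2real (\<Omega> u) \<le> c"
proof (cases "\<Omega> u < \<infinity>")
  case True
  then have "\<Omega> u = ennreal (enn2real (\<Omega> u))" by simp
  then have "tikhonov F v0 \<Omega> p \<alpha> u = ennreal (norm (F u - v0) powr p + \<alpha> * enn2real (\<Omega> u))"
    unfolding tikhonov_def using assms(1)
    by (metis ennreal_mult ennreal_plus enn2real_nonneg mult_nonneg_nonneg powr_ge_zero)
  then have "tikhonov F v0 \<Omega> p \<alpha> u \<le> ennreal c
      \<longleftrightarrow> norm (F u - v0) powr p + \<alpha> * enn2real (\<Omega> u) \<le> c"
    using ennreal_le_iff[OF assms(2)] by metis
  with True show ?thesis
    by (simp add: sublevel_def penalized_dom_def)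
qed (simp add: sublevel_def penalized_dom_def)

text \<open>Both summands are nonnegative, so each is at most \<open>c\<close>. The bounds supply
  compact intervals for extracting subsequences, and the second one bounds the residual in the final
  estimate.\<close>

lemma sublevel_bounds:
  assumes u: "u \<in> sublevel F DF v0 \<Omega> p \<alpha> c" and "0 < p" "0 < \<alpha>" "0 \<le> c"
  shows "enn2real (\<Omega> u) \<le> c / \<alpha>" "norm (F u - v0) \<le> c powr (1 / p)"
proof -
  have le: "norm (F u - v0) powr p + \<alpha> * enn2real (\<Omega> u) \<le> c"
    using u assms by (simp add: sublevel_iff)
  moreover have "0 \<le> norm (F u - v0) powr p" "0 \<le> \<alpha> * enn2real (\<Omega> u)"
    using assms by auto
  ultimately have le1: "norm (F u - v0) powr p \<le> c" and le2: "\<alpha> * enn2real (\<Omega> u) \<le> c"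
    by linarith+
  from le2 show "enn2real (\<Omega> u) \<le> c / \<alpha>"
    using assms by (simp add: field_simps)
  from le1 have "(norm (F u - v0) powr p) powr (1 / p) \<le> c powr (1 / p)"
    using assms by (intro powr_mono2) auto
  then show "norm (F u - v0) \<le> c powr (1 / p)"
    using assms by (simp add: powr_powr)
qed

text \<open>Finiteness of the limit value is a separate claim because \<open>enn2real\<close> maps
  infinity to 0.\<close>

lemma weakly_seq_lsc_enn2real_le:
  assumes lsc: "weakly_seq_lsc \<Omega>" and x: "weakly_tendsto x l" and fin: "\<And>k. \<Omega> (x k) < \<infinity>"
    and lim: "(\<lambda>k. enn2real (\<Omega> (x k))) \<longlonglongrightarrow> \<omega>"
  shows "\<Omega> l < \<infinity>" "enn2real (\<Omega> l) \<le> \<omega>"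
proof -
  have "(\<lambda>k. ennreal (enn2real (\<Omega> (x k)))) \<longlonglongrightarrow> ennreal \<omega>"
    using lim by (rule tendsto_ennrealI)
  then have "(\<lambda>k. \<Omega> (x k)) \<longlonglongrightarrow> ennreal \<omega>"
    using fin by simp
  then have "liminf (\<lambda>k. \<Omega> (x k)) = ennreal \<omega>"
    by (intro lim_imp_Liminf) auto
  with lsc x have le: "\<Omega> l \<le> ennreal \<omega>"
    unfolding weakly_seq_lsc_def by metis
  then show "\<Omega> l < \<infinity>"
    using order_le_less_trans[OF _ ennreal_less_top] by simp
  have "0 \<le> \<omega>"
    using lim by (rule LIMSEQ_le_const) auto
  with le show "enn2real (\<Omega> l) \<le> \<omega>"
    by (metis enn2real_ennreal enn2real_mono ennreal_less_top)
qed

text \<open>Besides a weak limit, the subsequence has convergent penalties and residuals. Lower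
  semicontinuity then compares values at \<open>l\<close> with genuine limits, and the inequality
  defining the sublevel set passes to \<open>l\<close>.\<close>

lemma sublevel_subsequence:
  fixes F :: "'u::real_normed_vector \<Rightarrow> 'v::real_normed_vector" and x :: "nat \<Rightarrow> 'u"
  assumes p: "0 < p" and \<alpha>: "0 < \<alpha>" and c: "0 \<le> c"
    and contF: "weakly_seq_continuous_on DF F" and DF: "weakly_seq_closed DF"
    and lsc: "weakly_seq_lsc \<Omega>"
    and pre: "weakly_seq_precompact (sublevel F DF v0 \<Omega> p \<alpha> c)"
    and x: "\<And>k. x k \<in> sublevel F DF v0 \<Omega> p \<alpha> c"
  obtains l s \<omega> \<nu> where "strict_mono (s :: nat \<Rightarrow> nat)" "l \<in> sublevel F DF v0 \<Omega> p \<alpha> c"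
    "weakly_tendsto (x \<circ> s) l"
    "(\<lambda>k. enn2real (\<Omega> (x (s k)))) \<longlonglongrightarrow> \<omega>" "enn2real (\<Omega> l) \<le> \<omega>"
    "(\<lambda>k. norm (F (x (s k)) - v0)) \<longlonglongrightarrow> \<nu>" "norm (F l - v0) \<le> \<nu>"
proof -
  obtain l s0 where s0: "strict_mono s0" "weakly_tendsto (x \<circ> s0) l"
    using pre x unfolding weakly_seq_precompact_def by blast
  define y where "y k = (enn2real (\<Omega> (x (s0 k))), norm (F (x (s0 k)) - v0))" for k
  have "y k \<in> {0..c / \<alpha>} \<times> {0..c powr (1 / p)}" for k
    using sublevel_bounds[OF x p \<alpha> c] by (auto simp: y_def)
  moreover have "compact ({0..c / \<alpha>} \<times> {0..c powr (1 / p)})"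
    by (intro compact_Times compact_Icc)
  ultimately obtain z s1 where s1: "strict_mono s1" "(y \<circ> s1) \<longlonglongrightarrow> z"
    unfolding compact_def by metis
  define s where "s = s0 \<circ> s1"
  have s: "strict_mono s"
    unfolding s_def using s0(1) s1(1) by (rule strict_mono_o)
  have w: "weakly_tendsto (x \<circ> s) l"
    using s0(2) LIMSEQ_subseq_LIMSEQ[OF _ s1(1)]
    unfolding weakly_tendsto_def s_def o_def by fast
  have lim1: "(\<lambda>k. enn2real (\<Omega> (x (s k)))) \<longlonglongrightarrow> fst z"
    and lim2: "(\<lambda>k. norm (F (x (s k)) - v0)) \<longlonglongrightarrow> snd z"
    using tendsto_fst[OF s1(2)] tendsto_snd[OF s1(2)] by (simp_all add: y_def s_def o_def)
  have xs: "x (s k) \<in> DF" "\<Omega> (x (s k)) < \<infinity>"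
    "norm (F (x (s k)) - v0) powr p + \<alpha> * enn2real (\<Omega> (x (s k))) \<le> c" for k
    using x[of "s k"] \<alpha> c by (auto simp: sublevel_iff)
  have l: "l \<in> DF"
    using DF[unfolded weakly_seq_closed_def, rule_format, of "x \<circ> s" l] w xs(1) by simp
  have le1: "\<Omega> l < \<infinity>" "enn2real (\<Omega> l) \<le> fst z"
    using weakly_seq_lsc_enn2real_le[OF lsc w] xs(2) lim1 by (simp_all add: o_def)
  have "weakly_tendsto (\<lambda>k. F (x (s k))) (F l)"
    using contF[unfolded weakly_seq_continuous_on_def, rule_format, of "x \<circ> s" l] w xs(1) l
    by (simp add: o_def)
  then have le2: "norm (F l - v0) \<le> snd z"
    using lim2 by (rule weakly_tendsto_norm_le)
  have "(\<lambda>k. norm (F (x (s k)) - v0) powr p + \<alpha> * enn2real (\<Omega> (x (s k))))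
      \<longlonglongrightarrow> snd z powr p + \<alpha> * fst z"
    \<comment> \<open>The limit residual may be 0; continuity of \<open>powr\<close> there relies on
      \<open>0 < p\<close>.\<close>
    using p by (intro tendsto_intros lim1 tendsto_powr' lim2) auto
  then have "snd z powr p + \<alpha> * fst z \<le> c"
    using xs(3) by (intro LIMSEQ_le_const2) auto
  moreover have "norm (F l - v0) powr p + \<alpha> * enn2real (\<Omega> l) \<le> snd z powr p + \<alpha> * fst z"
    using le1 le2 p \<alpha> by (intro add_mono powr_mono2 mult_left_mono) auto
  ultimately have "l \<in> sublevel F DF v0 \<Omega> p \<alpha> c"
    using l le1 \<alpha> c by (simp add: sublevel_iff)
  from that[OF s this w lim1 le1(2) lim2 le2] show ?thesis .
qed

text \<open>The direct method: the linear terms converge along a minimizing subsequence, while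
  penalty and residual are lower semicontinuous and carry the nonnegative weights
  \<open>\<beta>\<close> and \<open>b\<close>. The bound \<open>m\<close> makes the infimum a real
  lower bound.\<close>

lemma vi_functional_attains_min:
  fixes F :: "'u::real_normed_vector \<Rightarrow> 'v::real_normed_vector" and \<xi> :: "'u \<Rightarrow>\<^sub>L real"
    and ud :: 'u and \<Omega> :: "'u \<Rightarrow> ennreal" and \<beta> b \<kappa> :: real
  defines "J \<equiv> \<lambda>u. \<xi> (u - ud) + \<beta> * bregman \<Omega> \<xi> u ud + b * rpow (norm (F u - F ud)) \<kappa>"
  assumes p: "0 < p" and \<alpha>: "0 < \<alpha>" and c: "0 \<le> c"
    and contF: "weakly_seq_continuous_on DF F" and DF: "weakly_seq_closed DF"
    and lsc: "weakly_seq_lsc \<Omega>"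
    and pre: "weakly_seq_precompact (sublevel F DF (F ud) \<Omega> p \<alpha> c)"
    and \<beta>: "0 \<le> \<beta>" and b: "0 \<le> b" and \<kappa>: "0 < \<kappa>"
    and ne: "sublevel F DF (F ud) \<Omega> p \<alpha> c \<noteq> {}"
    and bdd: "\<And>u. u \<in> sublevel F DF (F ud) \<Omega> p \<alpha> c \<Longrightarrow> m \<le> J u"
  obtains u where "u \<in> sublevel F DF (F ud) \<Omega> p \<alpha> c"
    "\<And>v. v \<in> sublevel F DF (F ud) \<Omega> p \<alpha> c \<Longrightarrow> J u \<le> J v"
proof -
  define M where "M = sublevel F DF (F ud) \<Omega> p \<alpha> c"
  define I where "I = (INF u\<in>M. J u)"
  have I: "I \<le> J u" if "u \<in> M" for u
    unfolding I_def using that bdd by (intro cINF_lower bdd_belowI2) (auto simp: M_def)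
  have "\<exists>u\<in>M. J u < I + inverse (real (Suc k))" for k
  proof (rule ccontr)
    assume "\<not> ?thesis"
    then have "I + inverse (real (Suc k)) \<le> (INF u\<in>M. J u)"
      using ne by (intro cINF_greatest) (auto simp: M_def not_less)
    moreover have "0 < inverse (real (Suc k))" by simp
    ultimately show False by (simp add: I_def)
  qed
  then obtain x where x: "\<And>k. x k \<in> M" "\<And>k. J (x k) < I + inverse (real (Suc k))"
    by metis
  have Jx: "(\<lambda>k. J (x k)) \<longlonglongrightarrow> I"
  proof (rule tendsto_sandwich)
    show "\<forall>\<^sub>F k in sequentially. I \<le> J (x k)"
      using I x(1) by simp
    show "\<forall>\<^sub>F k in sequentially. J (x k) \<le> I + inverse (real (Suc k))"
      using x(2) by (intro always_eventually allI less_imp_le)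
    show "(\<lambda>k. I + inverse (real (Suc k))) \<longlonglongrightarrow> I"
      by (rule LIMSEQ_inverse_real_of_nat_add)
  qed (rule tendsto_const)
  obtain l s \<omega> \<nu> where s: "strict_mono s" and l: "l \<in> M" and w: "weakly_tendsto (x \<circ> s) l"
    and \<omega>: "(\<lambda>k. enn2real (\<Omega> (x (s k)))) \<longlonglongrightarrow> \<omega>" "enn2real (\<Omega> l) \<le> \<omega>"
    and \<nu>: "(\<lambda>k. norm (F (x (s k)) - F ud)) \<longlonglongrightarrow> \<nu>" "norm (F l - F ud) \<le> \<nu>"
    by (rule sublevel_subsequence[OF p \<alpha> c contF DF lsc pre x(1)[unfolded M_def], folded M_def])
  have \<xi>: "(\<lambda>k. \<xi> (x (s k) - ud)) \<longlonglongrightarrow> \<xi> (l - ud)"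
    using w[unfolded weakly_tendsto_def, rule_format, of \<xi>]
    unfolding blinfun.diff_right o_def by (rule tendsto_diff[OF _ tendsto_const])
  \<comment> \<open>\<open>G\<close> detaches penalty and residual values from the point, so that
    the limits \<open>\<omega>\<close>, \<open>\<nu>\<close> can be inserted together with
    \<open>l\<close>; it is monotone in both for nonnegative residuals.\<close>
  define G where "G \<omega> \<nu> u = \<xi> (u - ud) + \<beta> * (\<omega> - enn2real (\<Omega> ud) - \<xi> (u - ud)) + b * \<nu> powr \<kappa>"
    for \<omega> \<nu> u
  have J: "J u = G (enn2real (\<Omega> u)) (norm (F u - F ud)) u" for u
    using \<kappa> by (simp add: J_def G_def bregman_def rpow_def)
  have "(\<lambda>k. norm (F (x (s k)) - F ud) powr \<kappa>) \<longlonglongrightarrow> \<nu> powr \<kappa>"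
    using \<kappa> by (intro tendsto_powr' \<nu>(1) tendsto_const) auto
  then have "(\<lambda>k. J (x (s k))) \<longlonglongrightarrow> G \<omega> \<nu> l"
    unfolding J G_def by (intro tendsto_add tendsto_mult tendsto_diff tendsto_const \<xi> \<omega>(1))
  moreover have "(\<lambda>k. J (x (s k))) \<longlonglongrightarrow> I"
    using LIMSEQ_subseq_LIMSEQ[OF Jx s] by (simp add: o_def)
  ultimately have "G \<omega> \<nu> l = I"
    by (rule LIMSEQ_unique)
  moreover have "J l \<le> G \<omega> \<nu> l"
    unfolding J G_def using \<kappa> \<beta> b \<omega>(2) \<nu>(2)
    by (intro add_mono mult_left_mono powr_mono2 diff_mono order_refl) auto
  ultimately have "J l \<le> J v" if "v \<in> M" for v
    using I[OF that] by simp
  with l show ?thesis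
    unfolding M_def by (rule that)
qed

section \<open>From the degree of nonlinearity to the variational inequality\<close>

text \<open>The summand \<open>r * N\<close> is absorbed because \<open>1 - \<gamma> \<le> 0\<close>
  and \<open>1 - \<kappa> \<ge> 0\<close>, so \<open>r0\<close> and \<open>N0\<close> bound the
  surplus powers. Young's inequality handles the other summand.\<close>

lemma degree_interpolation:
  fixes r r0 N N0 B K c1 c2 :: real
  defines "\<gamma> \<equiv> 1 / (1 - c2)" and "\<kappa> \<equiv> c1 / (1 - c2)"
  assumes r: "0 < r0" "r0 \<le> r" and N: "0 \<le> N" "N \<le> N0" and B: "0 \<le> B" and K: "0 < K"
    and c2: "0 \<le> c2" "c2 < 1" and c1: "0 < c1" "c1 \<le> 1 - c2"
  shows "r * (N + K * rpow N c1 * rpow B c2)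
    \<le> c2 * B + (r0 powr (1 - \<gamma>) * N0 powr (1 - \<kappa>) + (1 - c2) * K powr \<gamma>) * r powr \<gamma> * N powr \<kappa>"
proof -
  have r_pos: "0 < r" using r by simp
  have \<gamma>: "1 \<le> \<gamma>" and \<kappa>: "\<kappa> \<le> 1"
    using c1 c2 by (auto simp: \<gamma>_def \<kappa>_def field_simps)
  have "r = r powr (1 - \<gamma>) * r powr \<gamma>"
    using r_pos by (simp flip: powr_add)
  also have "\<dots> \<le> r0 powr (1 - \<gamma>) * r powr \<gamma>"
    using r \<gamma> by (intro mult_right_mono powr_mono2') auto
  finally have r_le: "r \<le> r0 powr (1 - \<gamma>) * r powr \<gamma>" .
  have N_le: "N \<le> N0 powr (1 - \<kappa>) * N powr \<kappa>"
  proof (cases "N = 0")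
    case False
    with N have "N = N powr (1 - \<kappa>) * N powr \<kappa>"
      by (simp flip: powr_add)
    also have "\<dots> \<le> N0 powr (1 - \<kappa>) * N powr \<kappa>"
      using N \<kappa> by (intro mult_right_mono powr_mono2) auto
    finally show ?thesis .
  qed simp
  have "r * N \<le> (r0 powr (1 - \<gamma>) * r powr \<gamma>) * (N0 powr (1 - \<kappa>) * N powr \<kappa>)"
    using r_le N_le r_pos N by (intro mult_mono) auto
  moreover have "r * (K * rpow N c1 * rpow B c2)
    \<le> c2 * B + (1 - c2) * (K powr \<gamma> * r powr \<gamma> * N powr \<kappa>)"
  proof -
    have nonneg: "0 \<le> c2 * B + (1 - c2) * (K powr \<gamma> * r powr \<gamma> * N powr \<kappa>)"
      using c2 B by simp
    \<comment> \<open>For \<open>c2 = 0\<close> both sides agree, as \<open>rpow B 0 = 1\<close>; if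
      \<open>N = 0\<close>, or \<open>B = 0\<close> with \<open>c2 > 0\<close>, the left side
      vanishes. Young's inequality is left with positive arguments.\<close>
    consider "c2 = 0" | "N = 0" | "0 < c2" "B = 0" | "0 < c2" "0 < N" "0 < B"
      using c2 N B by linarith
    then show ?thesis
    proof cases
      case 1
      then show ?thesis using r_pos K c1 by (simp add: \<gamma>_def \<kappa>_def rpow_def)
    next
      case 2
      with nonneg c1 show ?thesis by (simp add: rpow_def)
    next
      case 3
      with nonneg show ?thesis by (simp add: rpow_def)
    next
      case 4
      \<comment> \<open>Chosen so that \<open>a powr (1 - c2)\<close> is the factor in front of
        \<open>B powr c2\<close>.\<close>
      define a where "a = (r * K * N powr c1) powr \<gamma>"
      have pos: "0 < r * K * N powr c1" using 4 r_pos K by simp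
      have "a powr (1 - c2) = r * K * N powr c1"
        using pos c2 by (simp add: a_def powr_powr \<gamma>_def)
      moreover have "a = K powr \<gamma> * r powr \<gamma> * N powr \<kappa>"
        using 4 r_pos K by (simp add: a_def powr_mult powr_powr \<gamma>_def \<kappa>_def)
      moreover have "a powr (1 - c2) * B powr c2 \<le> (1 - c2) * a + c2 * B"
        using pos 4 c2 by (intro Youngs_inequality_0) (auto simp: a_def)
      ultimately show ?thesis
        using 4 c1 by (simp add: rpow_def algebra_simps)
    qed
  qed
  ultimately show ?thesis by (simp add: algebra_simps)
qed

lemma subdifferential_bregman_nonneg:
  assumes "\<xi> \<in> subdifferential \<Omega> ud" "\<Omega> ud < \<infinity>" "\<Omega> u < \<infinity>"
  shows "0 \<le> bregman \<Omega> \<xi> u ud"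
proof -
  obtain a b where ab: "\<Omega> ud = ennreal a" "0 \<le> a" "\<Omega> u = ennreal b" "0 \<le> b"
    using assms(2,3) by (cases "\<Omega> ud"; cases "\<Omega> u") auto
  have "enn2ereal (\<Omega> ud) + ereal (\<xi> (u - ud)) \<le> enn2ereal (\<Omega> u)"
    using assms(1) by (simp add: subdifferential_def)
  with ab show ?thesis
    by (simp add: bregman_def enn2ereal_ennreal)
qed

lemma c_exp_ge_1: "1 \<le> c_exp p"
  by (simp add: c_exp_def ge_one_powr_ge_zero)

theorem theorem5p5:
  fixes F :: "'u::banach \<Rightarrow> 'v::banach"
    and DF :: "'u set"
    and v0 :: 'v
    and \<Omega> :: "'u \<Rightarrow> ennreal"
    and p :: real
    and ud :: 'u
    and F' :: "'u \<Rightarrow>\<^sub>L 'v"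
    and \<xi> :: "'u \<Rightarrow>\<^sub>L real"
    and c1 c2 \<rho> \<alpha>b K r0 K\<alpha> :: real
  assumes "reflexive_space TYPE('u)" and "reflexive_space TYPE('v)"
    and "0 < p"
    and "weakly_seq_continuous_on DF F"
    and "weakly_seq_closed DF"
    and "\<exists>u \<in> penalized_dom DF \<Omega>. F u = v0"
    and "convex_ennreal \<Omega>"
    and "weakly_seq_lsc \<Omega>"
    and "\<And>\<alpha> c. 0 < \<alpha> \<Longrightarrow> 0 < c \<Longrightarrow> weakly_seq_precompact (sublevel F DF v0 \<Omega> p \<alpha> c)"
    and "minimizing_solution F DF v0 \<Omega> ud"
    and "subdifferential \<Omega> ud \<noteq> {}"
    and "starlike_wrt DF ud"
    and "\<And>u. u \<in> penalized_dom DF \<Omega> \<Longrightarrow>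
          ((\<lambda>t. norm ((F (ud + t *\<^sub>R (u - ud)) - F ud) /\<^sub>R t - blinfun_apply F' (u - ud)))
             \<longlongrightarrow> 0) (at_right 0)"
    and "approx_source_condition F' \<Omega> ud \<xi>"
    and "nonlinear_of_degree F DF v0 \<Omega> p F' ud \<xi> c1 c2 \<rho> \<alpha>b K"
    and "c2 \<in> {0..<1}" and "c1 \<in> {0<..1 - c2}" and "c1 / (1 - c2) < p"
    and "0 < r0"
    and "0 < K\<alpha>"
    and "\<And>u. u \<in> sublevel F DF v0 \<Omega> p \<alpha>b (\<rho> * \<alpha>b) \<Longrightarrow> norm (u - ud) \<le> K\<alpha>"
  shows "c1 / (1 - c2) \<in> {0<..<p} \<and>
    (\<exists>\<beta>1 \<beta>2 \<gamma>. \<beta>1 \<in> {0..<1} \<and> 0 \<le> \<beta>2 \<and> 0 \<le> \<gamma> \<and>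
       approx_variational_inequality F DF v0 \<Omega> p ud \<xi> \<rho> \<alpha>b \<beta>1 \<beta>2 \<gamma> (c1 / (1 - c2)) \<and>
       (\<forall>r\<ge>r0. vi_distance F DF v0 \<Omega> p ud \<xi> \<rho> \<alpha>b \<beta>1 \<beta>2 \<gamma> (c1 / (1 - c2)) r
                  \<le> K\<alpha> * source_distance F' \<xi> r))"
proof -
  define M where "M = sublevel F DF v0 \<Omega> p \<alpha>b (\<rho> * \<alpha>b)"
  define \<gamma> where "\<gamma> = 1 / (1 - c2)"
  define \<kappa> where "\<kappa> = c1 / (1 - c2)"
  define N0 where "N0 = (\<rho> * \<alpha>b) powr (1 / p)"
  \<comment> \<open>The constant produced by \<open>degree_interpolation\<close>, with
    \<open>N0\<close> bounding the residual on \<open>M\<close>.\<close>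
  define \<beta>2 where
    "\<beta>2 = r0 powr (1 - \<gamma>) * N0 powr (1 - \<kappa>) + (1 - c2) * K powr \<gamma>"
  define J where "J r u = \<xi> (u - ud) + c2 * bregman \<Omega> \<xi> u ud
                + \<beta>2 * rpow r \<gamma> * rpow (norm (F u - F ud)) \<kappa>" for r u
  define d where "d = vi_distance F DF v0 \<Omega> p ud \<xi> \<rho> \<alpha>b c2 \<beta>2 \<gamma> \<kappa>"
  note p = \<open>0 < p\<close> and r0 = \<open>0 < r0\<close>
  have c2: "0 \<le> c2" "c2 < 1" and c1: "0 < c1" "c1 \<le> 1 - c2"
    using assms(16,17) by auto
  have \<gamma>: "1 \<le> \<gamma>" and \<kappa>: "0 < \<kappa>"
    using c1 c2 by (auto simp: \<gamma>_def \<kappa>_def field_simps)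
  have \<beta>2: "0 \<le> \<beta>2" using c2 by (simp add: \<beta>2_def)
  have sub: "\<xi> \<in> subdifferential \<Omega> ud" and clo: "\<xi> \<in> closure (range (adjoint_op F'))"
    using \<open>approx_source_condition F' \<Omega> ud \<xi>\<close> by (auto simp: approx_source_condition_def)
  have \<rho>: "ennreal (c_exp p) * \<Omega> ud < ennreal \<rho>" and \<alpha>b: "0 < \<alpha>b" and K: "0 < K"
    and degree: "\<And>u. u \<in> M \<Longrightarrow> norm (F u - F ud - F' (u - ud))
          \<le> K * rpow (norm (F u - F ud)) c1 * rpow (bregman \<Omega> \<xi> u ud) c2"
    using \<open>nonlinear_of_degree F DF v0 \<Omega> p F' ud \<xi> c1 c2 \<rho> \<alpha>b K\<close>
    by (auto simp: nonlinear_of_degree_def M_def)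
  have ud: "ud \<in> DF" "\<Omega> ud < \<infinity>" "F ud = v0"
    using \<open>minimizing_solution F DF v0 \<Omega> ud\<close>
    by (auto simp: minimizing_solution_def penalized_dom_def)
  have \<rho>_pos: "0 < \<rho>"
    using \<rho> by (metis ennreal_eq_0_iff not_less not_less_zero)
  have c_pos: "0 < \<rho> * \<alpha>b" using \<rho>_pos \<alpha>b by simp
  \<comment> \<open>The residual vanishes at \<open>ud\<close>, and \<open>c_exp p \<ge> 1\<close>
    gives \<open>\<Omega> ud < \<rho>\<close>. As a competitor with value 0, \<open>ud\<close> later
    yields \<open>0 \<le> d r\<close>.\<close>
  have ud_M: "ud \<in> M"
  proof -
    have "1 * \<Omega> ud \<le> ennreal (c_exp p) * \<Omega> ud"
      using c_exp_ge_1[of p] by (intro mult_right_mono) (auto simp flip: ennreal_1 intro: ennreal_leI)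
    with \<rho> have "\<Omega> ud < ennreal \<rho>" by simp
    then have "enn2real (\<Omega> ud) \<le> \<rho>"
      using \<rho>_pos by (intro enn2real_leI) auto
    then have "\<alpha>b * enn2real (\<Omega> ud) \<le> \<rho> * \<alpha>b"
      using \<alpha>b by (simp add: mult.commute)
    with ud c_pos \<alpha>b show ?thesis
      unfolding M_def by (subst sublevel_iff) auto
  qed
  \<comment> \<open>This bound serves twice: it makes the infimum of \<open>J r\<close> finite, and
    at the minimizer it is the claimed estimate of \<open>d r\<close>.\<close>
  have lower: "- (K\<alpha> * source_distance F' \<xi> r) \<le> J r u" if r: "r0 \<le> r" and u: "u \<in> M" for r u
  proof -
    define N where "N = norm (F u - F ud)"
    define B where "B = bregman \<Omega> \<xi> u ud"
    have N: "0 \<le> N" "N \<le> N0"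
      using sublevel_bounds(2)[OF u[unfolded M_def] p \<alpha>b] c_pos ud by (auto simp: N_def N0_def)
    have "\<Omega> u < \<infinity>" using u by (simp add: M_def sublevel_def penalized_dom_def)
    then have B: "0 \<le> B"
      unfolding B_def using sub ud by (intro subdifferential_bregman_nonneg)
    obtain \<eta> where \<eta>: "norm \<eta> \<le> r" "source_distance F' \<xi> r = norm (\<xi> - adjoint_op F' \<eta>)"
      using source_distance_attained[of r F' \<xi>] r r0 by auto
    have "- ((\<xi> - adjoint_op F' \<eta>) (u - ud)) \<le> K\<alpha> * source_distance F' \<xi> r"
    proof -
      have "- ((\<xi> - adjoint_op F' \<eta>) (u - ud)) \<le> norm (\<xi> - adjoint_op F' \<eta>) * norm (u - ud)"
        using norm_blinfun[of "\<xi> - adjoint_op F' \<eta>" "u - ud"]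
        by (auto simp only: real_norm_def abs_le_iff)
      also have "\<dots> \<le> norm (\<xi> - adjoint_op F' \<eta>) * K\<alpha>"
        using assms(21)[of u] u by (intro mult_left_mono) (auto simp: M_def)
      finally show ?thesis by (simp add: \<eta>(2) mult.commute)
    qed
    moreover have "- \<eta> (F' (u - ud)) \<le> r * (N + K * rpow N c1 * rpow B c2)"
    proof -
      have "- \<eta> (F' (u - ud)) \<le> norm \<eta> * norm (F' (u - ud))"
        using norm_blinfun[of \<eta> "F' (u - ud)"] by (auto simp only: real_norm_def abs_le_iff)
      \<comment> \<open>\<open>F' (u - ud)\<close> is the increment of \<open>F\<close> minus the
        linearization error.\<close>
      also have "norm (F' (u - ud)) \<le> N + norm (F u - F ud - F' (u - ud))"
        using norm_triangle_ineq4[of "F u - F ud" "F u - F ud - F' (u - ud)"] by (simp add: N_def)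
      also have "\<dots> \<le> N + K * rpow N c1 * rpow B c2"
        using degree[OF u] by (simp add: N_def B_def)
      finally have "- \<eta> (F' (u - ud)) \<le> norm \<eta> * (N + K * rpow N c1 * rpow B c2)"
        by (simp add: mult_left_mono)
      also have "\<dots> \<le> r * (N + K * rpow N c1 * rpow B c2)"
        using \<eta>(1) N K by (intro mult_right_mono) (auto simp: rpow_def)
      finally show ?thesis .
    qed
    moreover have "r * (N + K * rpow N c1 * rpow B c2) \<le> c2 * B + \<beta>2 * r powr \<gamma> * N powr \<kappa>"
      unfolding \<beta>2_def \<gamma>_def \<kappa>_def by (rule degree_interpolation[OF r0 r N B K c2 c1])
    moreover have "\<xi> (u - ud) = (\<xi> - adjoint_op F' \<eta>) (u - ud) + \<eta> (F' (u - ud))"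
      by (simp add: adjoint_op_def blinfun.diff_left)
    moreover have "J r u = \<xi> (u - ud) + c2 * B + \<beta>2 * r powr \<gamma> * N powr \<kappa>"
      using \<gamma> \<kappa> by (simp add: J_def N_def B_def rpow_def)
    ultimately show ?thesis by linarith
  qed
  have d: "0 \<le> d r \<and> d r \<le> K\<alpha> * source_distance F' \<xi> r" if r: "r0 \<le> r" for r
  proof -
    have pre: "weakly_seq_precompact (sublevel F DF (F ud) \<Omega> p \<alpha>b (\<rho> * \<alpha>b))"
      unfolding ud by (rule assms(9)[OF \<alpha>b c_pos])
    have b: "0 \<le> \<beta>2 * rpow r \<gamma>"
      using \<beta>2 \<gamma> by (simp add: rpow_def)
    obtain u where u: "u \<in> M" "\<And>v. v \<in> M \<Longrightarrow> J r u \<le> J r v"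
    proof (rule vi_functional_attains_min[OF p \<alpha>b less_imp_le[OF c_pos] assms(4,5,8) pre c2(1) b \<kappa>])
      show "sublevel F DF (F ud) \<Omega> p \<alpha>b (\<rho> * \<alpha>b) \<noteq> {}"
        using ud_M ud by (auto simp: M_def)
      show "- (K\<alpha> * source_distance F' \<xi> r) \<le> \<xi> (u - ud) + c2 * bregman \<Omega> \<xi> u ud
            + \<beta>2 * rpow r \<gamma> * rpow (norm (F u - F ud)) \<kappa>"
        if "u \<in> sublevel F DF (F ud) \<Omega> p \<alpha>b (\<rho> * \<alpha>b)" for u
        using lower[OF r, of u] that ud by (simp add: J_def M_def)
    qed (use ud in \<open>auto simp: M_def J_def\<close>)
    \<comment> \<open>Attainment identifies the \<open>LEAST\<close> value in the distance function
      with \<open>J r u\<close>.\<close>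
    have "d r = - J r u"
      unfolding d_def vi_distance_def M_def[symmetric] J_def[symmetric]
      using u by (intro arg_cong[where f = uminus] Least_equality) auto
    moreover have "J r ud = 0"
      using \<kappa> by (simp add: J_def bregman_def rpow_def blinfun.zero_right)
    ultimately show ?thesis
      using u(2)[OF ud_M] lower[OF r u(1)] by simp
  qed
  have "(d \<longlongrightarrow> 0) at_top"
  proof (rule tendsto_sandwich)
    show "\<forall>\<^sub>F r in at_top. 0 \<le> d r" "\<forall>\<^sub>F r in at_top. d r \<le> K\<alpha> * source_distance F' \<xi> r"
      using d unfolding eventually_at_top_linorder by blast+
    show "((\<lambda>r. K\<alpha> * source_distance F' \<xi> r) \<longlongrightarrow> 0) at_top"
      using tendsto_mult[OF tendsto_const source_distance_tendsto_0[OF clo]] by simp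
  qed simp
  then have "approx_variational_inequality F DF v0 \<Omega> p ud \<xi> \<rho> \<alpha>b c2 \<beta>2 \<gamma> \<kappa>"
    using sub \<rho> \<alpha>b c2 \<beta>2 \<gamma> \<kappa> by (simp add: approx_variational_inequality_def d_def)
  moreover have "\<kappa> \<in> {0<..<p}"
    using \<kappa> \<open>c1 / (1 - c2) < p\<close> by (simp add: \<kappa>_def)
  ultimately show ?thesis
    unfolding \<kappa>_def[symmetric] using d c2 \<beta>2 \<gamma>
    by (intro conjI exI[of _ c2] exI[of _ \<beta>2] exI[of _ \<gamma>]) (auto simp: d_def)
qed

end
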